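(* Let $\mathfrak g$ be any simple Lie algebra and ${\bf i}=(i_1,\dots,i_k)$ any reduced word of an element of its Weyl group. Then the cellular crystal $B_{\bf i}=B_{i_1}\otimes B_{i_2}\otimes\cdots\otimes B_{i_k}$ is connected as a crystal graph.
   Context: $\mathfrak g$ has index set $I$, simple roots $\alpha_i$, coroots $h_i$. For $i\in I$, $B_i=\{(x)_i\mid x\in\mathbb Z\}$ is the crystal with ${\rm wt}((x)_i)=x\alpha_i$, $\varepsilon_i((x)_i)=-x$, $\varphi_i((x)_i)=x$, $\tilde e_i(x)_i=(x+1)_i$, $\tilde f_i(x)_i=(x-1)_i$, and for $j\ne i$: $\varepsilon_j((x)_i)=\varphi_j((x)_i)=-\infty$, $\tilde e_j(x)_i=\tilde f_j(x)_i=0$. Tensor product of crystals: ${\rm wt}(b_1\otimes b_2)={\rm wt}(b_1)+{\rm wt}(b_2)$, $\varepsilon_i(b_1\otimes b_2)=\max(\varepsilon_i(b_1),\varepsilon_i(b_2)-\langle h_i,{\rm wt}(b_1)\rangle)$, $\varphi_i(b_1\otimes b_2)=\max(\varphi_i(b_2),\varphi_i(b_1)+\langle h_i,{\rm wt}(b_2)\rangle)$, $\tilde e_i(b_1\otimes b_2)=\tilde e_ib_1\otimes b_2$ if $\varphi_i(b_1)\ge\varepsilon_i(b_2)$ and $b_1\otimes\tilde e_ib_2$ otherwise, $\tilde f_i(b_1\otimes b_2)=\tilde f_ib_1\otimes b_2$ if $\varphi_i(b_1)>\varepsilon_i(b_2)$ and $b_1\otimes\tilde f_ib_2$ otherwise.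 The crystal graph of a crystal $B$ has vertex set $B$ and an edge $b\to\tilde f_ib$ whenever $\tilde f_ib\ne0$; connected means connected as an (undirected) graph. *)

theory Defs
  imports "HOL-Library.Extended_Real" "HOL-Combinatorics.Permutations"
begin

(* Index set I = UNIV of a finite type 'i; A i j = <h_i, alpha_j> (Cartan matrix). *)

definition principal_minor :: "('i \<Rightarrow> 'i \<Rightarrow> int) \<Rightarrow> 'i set \<Rightarrow> int" where
  "principal_minor A J = (\<Sum>p\<in>{p. p permutes J}. sign p * (\<Prod>j\<in>J. A j (p j)))"

definition gen_cartan :: "('i \<Rightarrow> 'i \<Rightarrow> int) \<Rightarrow> bool" where
  "gen_cartan A \<longleftrightarrow> (\<forall>i. A i i = 2) \<and> (\<forall>i j. i \<noteq> j \<longrightarrow> A i j \<le> 0)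
     \<and> (\<forall>i j. A i j = 0 \<longleftrightarrow> A j i = 0)"

definition indecomposable :: "('i \<Rightarrow> 'i \<Rightarrow> int) \<Rightarrow> bool" where
  "indecomposable A \<longleftrightarrow>
     (\<forall>J. J \<noteq> {} \<and> J \<noteq> UNIV \<longrightarrow> (\<exists>j\<in>J. \<exists>k. k \<notin> J \<and> A j k \<noteq> 0))"

(* finite type: all principal minors positive (Kac, Thm 4.3) *)
definition finite_type :: "('i::finite \<Rightarrow> 'i \<Rightarrow> int) \<Rightarrow> bool" where
  "finite_type A \<longleftrightarrow> gen_cartan A \<and> (\<forall>J. J \<noteq> {} \<longrightarrow> principal_minor A J > 0)"

(* Cartan matrix of a (finite-dimensional complex) simple Lie algebra *)
definition simple_cartan :: "('i::finite \<Rightarrow> 'i \<Rightarrow> int) \<Rightarrow> bool" where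
  "simple_cartan A \<longleftrightarrow> finite_type A \<and> indecomposable A"

(* weights in the root lattice: coefficients on simple roots; <h_i, lambda> *)
definition pairing :: "('i::finite \<Rightarrow> 'i \<Rightarrow> int) \<Rightarrow> 'i \<Rightarrow> ('i \<Rightarrow> int) \<Rightarrow> int" where
  "pairing A i l = (\<Sum>j\<in>UNIV. A i j * l j)"

(* simple reflection s_i(lambda) = lambda - <h_i,lambda> alpha_i *)
definition refl :: "('i::finite \<Rightarrow> 'i \<Rightarrow> int) \<Rightarrow> 'i \<Rightarrow> ('i \<Rightarrow> int) \<Rightarrow> ('i \<Rightarrow> int)" where
  "refl A i l = (\<lambda>j. l j - (if j = i then pairing A i l else 0))"

(* Weyl group element s_{i_1} ... s_{i_k} *)
definition weyl_word :: "('i::finite \<Rightarrow> 'i \<Rightarrow> int) \<Rightarrow> 'i list \<Rightarrow> ('i \<Rightarrow> int) \<Rightarrow> ('i \<Rightarrow> int)" where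
  "weyl_word A w = foldr (\<lambda>i f. refl A i \<circ> f) w id"

definition reduced_word :: "('i::finite \<Rightarrow> 'i \<Rightarrow> int) \<Rightarrow> 'i list \<Rightarrow> bool" where
  "reduced_word A w \<longleftrightarrow> (\<forall>w'. weyl_word A w' = weyl_word A w \<longrightarrow> length w \<le> length w')"

(* the crystal B_{i_1} (x) ... (x) B_{i_k}; elements (x_1)_{i_1} (x) ... (x) (x_k)_{i_k} are int lists *)
fun cwt :: "'i list \<Rightarrow> int list \<Rightarrow> ('i \<Rightarrow> int)" where
  "cwt (k # w) (x # b) = (\<lambda>j. (if j = k then x else 0) + cwt w b j)"
| "cwt _ _ = (\<lambda>_. 0)"

definition eps1 :: "'i \<Rightarrow> 'i \<Rightarrow> int \<Rightarrow> ereal" where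
  "eps1 i k x = (if i = k then ereal (real_of_int (- x)) else -\<infinity>)"

definition phi1 :: "'i \<Rightarrow> 'i \<Rightarrow> int \<Rightarrow> ereal" where
  "phi1 i k x = (if i = k then ereal (real_of_int x) else -\<infinity>)"

fun ceps :: "('i::finite \<Rightarrow> 'i \<Rightarrow> int) \<Rightarrow> 'i \<Rightarrow> 'i list \<Rightarrow> int list \<Rightarrow> ereal" where
  "ceps A i [k] [x] = eps1 i k x"
| "ceps A i (k # k' # w) (x # y # b) =
     max (eps1 i k x) (ceps A i (k' # w) (y # b) - ereal (real_of_int (x * A i k)))"
| "ceps A i _ _ = -\<infinity>"

fun cphi :: "('i::finite \<Rightarrow> 'i \<Rightarrow> int) \<Rightarrow> 'i \<Rightarrow> 'i list \<Rightarrow> int list \<Rightarrow> ereal" where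
  "cphi A i [k] [x] = phi1 i k x"
| "cphi A i (k # k' # w) (x # y # b) =
     max (cphi A i (k' # w) (y # b))
         (phi1 i k x + ereal (real_of_int (pairing A i (cwt (k' # w) (y # b)))))"
| "cphi A i _ _ = -\<infinity>"

(* Kashiwara operator f_i; None represents 0 *)
fun cf :: "('i::finite \<Rightarrow> 'i \<Rightarrow> int) \<Rightarrow> 'i \<Rightarrow> 'i list \<Rightarrow> int list \<Rightarrow> int list option" where
  "cf A i [k] [x] = (if i = k then Some [x - 1] else None)"
| "cf A i (k # k' # w) (x # y # b) =
     (if phi1 i k x > ceps A i (k' # w) (y # b)
      then (if i = k then Some ((x - 1) # y # b) else None)
      else map_option (Cons x) (cf A i (k' # w) (y # b)))"
| "cf A i _ _ = None"

fun ce :: "('i::finite \<Rightarrow> 'i \<Rightarrow> int) \<Rightarrow> 'i \<Rightarrow> 'i list \<Rightarrow> int list \<Rightarrow> int list option" where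
  "ce A i [k] [x] = (if i = k then Some [x + 1] else None)"
| "ce A i (k # k' # w) (x # y # b) =
     (if phi1 i k x \<ge> ceps A i (k' # w) (y # b)
      then (if i = k then Some ((x + 1) # y # b) else None)
      else map_option (Cons x) (ce A i (k' # w) (y # b)))"
| "ce A i _ _ = None"

definition cellular_crystal :: "'i list \<Rightarrow> int list set" where
  "cellular_crystal w = {b. length b = length w}"

(* edges b -> f_i b of the crystal graph *)
definition crystal_edges :: "('i::finite \<Rightarrow> 'i \<Rightarrow> int) \<Rightarrow> 'i list \<Rightarrow> (int list \<times> int list) set" where
  "crystal_edges A w = {(b, b'). b \<in> cellular_crystal w \<and> (\<exists>i. cf A i w b = Some b')}"

definition crystal_connected :: "('i::finite \<Rightarrow> 'i \<Rightarrow> int) \<Rightarrow> 'i list \<Rightarrow> bool" where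
  "crystal_connected A w \<longleftrightarrow>
     (\<forall>b\<in>cellular_crystal w. \<forall>b'\<in>cellular_crystal w.
        (b, b') \<in> (crystal_edges A w \<union> (crystal_edges A w)\<inverse>)\<^sup>*)"

end

theory Submission
  imports Defs "HOL-Analysis.Determinants"
begin

text \<open>
  Write a_m = - x_m - sum over j < m of <h_i, alpha_{i_j}> x_j for the positions m with i_m = i. The
  operator f_i decreases x_m at the last position where a_m is maximal, and e_i increases x_m at the
  first one. Hence adding a vector v for which a_m depends only on the letter i_m is an automorphism
  of the crystal graph. Every weight nu yields such a vector, namely
  v_m = - <h_{i_m}, s_{i_{m-1}} ... s_{i_1} nu>, and for strictly dominant nu all v_m are negative
  because the word is reduced.

  For N large, x + N v is joined to the origin: going from left to right, apply e_{i_m}. The earlier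
  coordinates are already zero and have signature zero, while the later signatures are large and
  positive; after a number of steps independent of N only x_m moves, until it reaches zero. So any
  x and y are joined after translation by the same N v, and therefore also before.\<close>

section \<open>Positivity of reduced words\<close>

lemma weyl_word_Nil [simp]: "weyl_word A [] = id"
  by (simp add: weyl_word_def)

lemma weyl_word_Cons [simp]: "weyl_word A (i # u) = refl A i \<circ> weyl_word A u"
  by (simp add: weyl_word_def)

lemma weyl_word_append [simp]: "weyl_word A (u @ v) = weyl_word A u \<circ> weyl_word A v"
  by (induction u) (simp_all add: comp_assoc)

lemma pairing_refl: "pairing A j (refl A i l) = pairing A j l - A j i * pairing A i l"
proof -
  have "(\<Sum>k\<in>UNIV. A j k * (if k = i then c else 0)) = A j i * c" for c
    by (simp add: if_distrib cong: if_cong)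
  then show ?thesis
    by (simp add: pairing_def refl_def right_diff_distrib sum_subtractf)
qed

lemma refl_apply: "refl A i l c = l c - (if c = i then pairing A i l else 0)"
  by (simp add: refl_def)

lemma refl_refl:
  assumes "A i i = 2"
  shows "refl A i (refl A i l) = l"
  using assms by (auto simp: fun_eq_iff refl_apply pairing_refl)

lemma gen_cartan_diag: "gen_cartan A \<Longrightarrow> A i i = 2"
  by (simp add: gen_cartan_def)

lemma weyl_word_rev:
  assumes "gen_cartan A"
  shows "weyl_word A u \<circ> weyl_word A (rev u) = id"
proof (induction u)
  case (Cons i u)
  have "weyl_word A u (weyl_word A (rev u) x) = x" for x
    using Cons.IH by (metis comp_apply id_apply)
  then show ?case
    using assms by (simp add: gen_cartan_diag refl_refl comp_def id_def)
qed simp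

text \<open>Reflections are involutions, so reversing a word inverts its element. The inverse is
  needed because <u h_i, \<nu>> = <h_i, u^{-1} \<nu>>, and the reversed word computes
  u^{-1}.\<close>

lemma weyl_word_rev_cong:
  assumes "gen_cartan A" and "weyl_word A u = weyl_word A v"
  shows "weyl_word A (rev u) = weyl_word A (rev v)"
proof -
  have "weyl_word A (rev u) = weyl_word A (rev u) \<circ> (weyl_word A u \<circ> weyl_word A (rev v))"
    using weyl_word_rev[OF assms(1), where u = v] assms(2) by simp
  also have "\<dots> = weyl_word A (rev v)"
    using weyl_word_rev[OF assms(1), where u = "rev u"] by (simp flip: comp_assoc)
  finally show ?thesis .
qed

text \<open>The determinant of this matrix detects the parity of the word length.\<close>
definition weyl_matrix :: "('i::finite \<Rightarrow> 'i \<Rightarrow> int) \<Rightarrow> 'i list \<Rightarrow> real ^ 'i ^ 'i" where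
  "weyl_matrix A u = (\<chi> r c. of_int (weyl_word A u (\<lambda>j. if j = c then 1 else 0) r))"

lemma refl_unit:
  fixes A :: "'i::finite \<Rightarrow> 'i \<Rightarrow> int"
  shows "refl A i (\<lambda>j. if j = k then 1 else 0) r = (if r = k then 1 else 0) - (if r = i then A i k else 0)"
proof -
  have "pairing A i (\<lambda>j. if j = k then 1 else 0) = (\<Sum>j\<in>UNIV. if j = k then A i j else 0)"
    unfolding pairing_def by (intro sum.cong) auto
  then show ?thesis by (simp add: refl_def)
qed

lemma weyl_matrix_Cons: "weyl_matrix A (i # u) = weyl_matrix A [i] ** weyl_matrix A u"
proof -
  have *: "of_int (refl A i l r) =
      (\<Sum>k\<in>UNIV. of_int (refl A i (\<lambda>j. if j = k then 1 else 0) r) * (of_int (l k) :: real))"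
    (is "_ = ?S") for l r
  proof -
    have "?S = (\<Sum>k\<in>UNIV. (if k = r then of_int (l k) else 0) -
        (if r = i then of_int (A i k) * of_int (l k) else 0))"
      by (intro sum.cong) (auto simp: refl_unit algebra_simps)
    also have "\<dots> = of_int (l r) -
        (if r = i then \<Sum>k\<in>UNIV. of_int (A i k) * of_int (l k) else 0)"
      by (simp add: sum_subtractf)
    finally show ?thesis
      by (simp add: refl_def pairing_def)
  qed
  show ?thesis
    by (simp add: weyl_matrix_def matrix_matrix_mult_def vec_eq_iff flip: *)
qed

text \<open>A reflection differs from the identity only in row \<open>i\<close>, which becomes the
  unit row minus row \<open>i\<close> of \<open>A\<close>. Cramer's lemma for rows then gives its
  \<open>i\<close>-th entry, 1 - 2, as determinant.\<close>

lemma det_weyl_matrix_single: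
  fixes A :: "'i::finite \<Rightarrow> 'i \<Rightarrow> int"
  assumes "A i i = 2"
  shows "det (weyl_matrix A [i]) = - 1"
proof -
  define x :: "real ^ 'i" where "x = (\<chi> c. (if c = i then 1 else 0) - of_int (A i c))"
  have "(\<Sum>k\<in>UNIV. x $ k *s row k (mat 1 :: real ^ 'i ^ 'i)) = x"
  proof -
    have "(\<Sum>k\<in>UNIV. x $ k * (if k = c then 1 else 0)) = x $ c" for c
      using sum.delta[of UNIV c "\<lambda>k. x $ k"] by (simp add: if_distrib[of "(*) _"] cong: if_cong)
    then show ?thesis
      by (simp add: vec_eq_iff row_def mat_def)
  qed
  then have "weyl_matrix A [i] =
      (\<chi> r. if r = i then \<Sum>k\<in>UNIV. x $ k *s row k (mat 1) else row r (mat 1))"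
    by (auto simp: weyl_matrix_def x_def vec_eq_iff refl_unit row_def mat_def)
  then have "det (weyl_matrix A [i]) = x $ i * det (mat 1 :: real ^ 'i ^ 'i)"
    using cramer_lemma_transpose[of i x "mat 1"] by simp
  then show ?thesis
    using assms by (simp add: x_def)
qed

lemma det_weyl_matrix:
  assumes "gen_cartan A"
  shows "det (weyl_matrix A u) = (- 1) ^ length u"
proof (induction u)
  case Nil
  have "weyl_matrix A [] = mat 1"
    by (simp add: weyl_matrix_def mat_def vec_eq_iff)
  then show ?case by simp
next
  case (Cons i u)
  then show ?case
    using assms by (subst weyl_matrix_Cons) (simp add: gen_cartan_diag det_mul det_weyl_matrix_single)
qed

text \<open>Consequence used below: a word that is not reduced is equivalent to one shorter by at
  least two letters.\<close>

lemma weyl_word_parity: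
  assumes "gen_cartan A" and "weyl_word A u = weyl_word A v"
  shows "even (length u) \<longleftrightarrow> even (length v)"
proof -
  have "weyl_matrix A u = weyl_matrix A v"
    using assms(2) by (simp add: weyl_matrix_def)
  then have "(- 1 :: real) ^ length u = (- 1) ^ length v"
    using det_weyl_matrix[OF assms(1)] by metis
  then show ?thesis
    by (cases "even (length u)"; cases "even (length v)") auto
qed

section \<open>Subwords and cancellation in reduced words\<close>

lemma reduced_word_infix:
  assumes "reduced_word A (u @ v @ x)"
  shows "reduced_word A v"
  unfolding reduced_word_def
proof (intro allI impI)
  fix v' assume "weyl_word A v' = weyl_word A v"
  then have "weyl_word A (u @ v' @ x) = weyl_word A (u @ v @ x)" by simp
  then have "length (u @ v @ x) \<le> length (u @ v' @ x)"
    using assms unfolding reduced_word_def by blast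
  then show "length v \<le> length v'" by simp
qed

lemma reduced_word_cong:
  assumes "reduced_word A u" "weyl_word A v = weyl_word A u" "length v \<le> length u"
  shows "reduced_word A v"
  using assms unfolding reduced_word_def by (metis le_trans)

text \<open>Meant for braid relations: \<open>s\<close> and \<open>s' @ [x]\<close> are words of
  equal length for one element, so a further \<open>x\<close> cancels and leaves the shorter
  \<open>s'\<close>.\<close>

lemma not_reduced_word_snoc:
  assumes "A x x = 2" "weyl_word A s = weyl_word A (s' @ [x])" "length s = Suc (length s')"
  shows "\<not> reduced_word A (s @ [x])"
proof
  assume "reduced_word A (s @ [x])"
  moreover have "weyl_word A s' = weyl_word A (s @ [x])"
    using assms by (simp add: fun_eq_iff refl_refl)
  ultimately have "length (s @ [x]) \<le> length s'"
    unfolding reduced_word_def by blast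
  then show False using assms(3) by simp
qed

lemma not_reduced_word_square:
  fixes x :: "'a::finite"
  assumes "A x x = 2"
  shows "\<not> reduced_word A [x, x]"
proof
  assume "reduced_word A [x, x]"
  moreover have "weyl_word A [] = weyl_word A [x, x]"
    using assms by (simp add: fun_eq_iff refl_refl)
  ultimately have "length [x, x] \<le> length ([] :: 'a list)"
    unfolding reduced_word_def by blast
  then show False by simp
qed

section \<open>Rank two: alternating words\<close>

fun alt :: "'a \<Rightarrow> 'a \<Rightarrow> nat \<Rightarrow> 'a list" where
  "alt x y 0 = []"
| "alt x y (Suc n) = x # alt y x n"

lemma alt_le_append:
  assumes "m \<le> n"
  shows "\<exists>r. alt x y n = alt x y m @ r"
  using assms
proof (induction m arbitrary: x y n)
  case (Suc m)
  then obtain n' where n': "n = Suc n'" "m \<le> n'" by (cases n) auto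
  from Suc.IH[OF n'(2), of y x] show ?case by (auto simp: n')
qed simp

text \<open>Equal adjacent letters cancel, so a reduced word in two letters alternates. The reversed
  form reads the word from its last letter, the one whose positivity is tested.\<close>

lemma reduced_word_alternating:
  assumes "gen_cartan A" "reduced_word A (rev (x # s))" "set s \<subseteq> {x, y}" "x \<noteq> y"
  shows "s = alt y x (length s)"
  using assms(2-4)
proof (induction s arbitrary: x y)
  case (Cons z s)
  have "z \<noteq> x"
    using Cons.prems(1) reduced_word_infix[of A "rev s" "[x, x]" "[]"]
      not_reduced_word_square[of A x] gen_cartan_diag[OF assms(1)] by auto
  then have z: "z = y" using Cons.prems(2) by auto
  have "reduced_word A (rev (z # s))"
    using Cons.prems(1) reduced_word_infix[of A "[]" "rev (z # s)" "[x]"] by simp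
  then have "s = alt x y (length s)"
    using Cons.IH[of y x] Cons.prems z by (auto simp: insert_commute)
  then show ?case using z by simp
qed simp

text \<open>The off-diagonal entries of types A1 x A1, A2, B2 and G2, the last two in both
  orders.\<close>

lemma rank2_cases:
  fixes a b :: int
  assumes "a \<le> 0" "b \<le> 0" "a = 0 \<longleftrightarrow> b = 0" "a * b < 4"
  shows "(a, b) \<in> {(0,0), (-1,-1), (-1,-2), (-2,-1), (-1,-3), (-3,-1)}"
proof (cases "a = 0")
  case False
  then have ab: "a \<le> -1" "b \<le> -1" using assms by auto
  have "0 \<le> (- a - 1) * (- b)"
    by (rule mult_nonneg_nonneg) (use ab in auto)
  moreover have "0 \<le> (- a) * (- b - 1)"
    by (rule mult_nonneg_nonneg) (use ab in auto)
  ultimately have "- b \<le> 3" "- a \<le> 3"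
    using assms(4) by (auto simp: algebra_simps)
  then have "a \<in> {-1,-2,-3}" "b \<in> {-1,-2,-3}" using ab by auto
  then show ?thesis using assms(4) by auto
qed (use assms in auto)

text \<open>Checked type by type. The braid relation of length 2, 3, 4 or 6 bounds the length of
  \<open>t\<close> strictly by that number, and for each remaining length the pairing is a
  nonnegative, nonzero combination of the two positive pairings.\<close>

lemma rank2_pos:
  fixes A :: "'i::finite \<Rightarrow> 'i \<Rightarrow> int"
  assumes gc: "gen_cartan A" and ij: "i \<noteq> j" and lt: "A i j * A j i < 4"
    and red: "reduced_word A (t @ [i])" and st: "set t \<subseteq> {i, j}"
    and pos: "pairing A i \<mu> > 0" "pairing A j \<mu> > 0"
  shows "pairing A i (weyl_word A (rev t) \<mu>) > 0"
proof -
  have d: "\<forall>i. A i i = 2" using gc by (simp add: gen_cartan_def)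
  define n where "n = length t"
  have t: "rev t = alt j i n"
    using reduced_word_alternating[of A i "rev t" j] gc red st ij by (simp add: n_def)
  \<comment> \<open>\<open>rev (alt i j (Suc m))\<close> is the alternating word of
    \<open>Suc m\<close> letters ending in \<open>i\<close>. If \<open>t\<close> had at least
    \<open>m\<close> letters, that word would be a suffix of the reduced word
    \<open>t @ [i]\<close>.\<close>
  have bound: "n < m" if "\<not> reduced_word A (rev (alt i j (Suc m)))" for m
  proof (rule ccontr)
    assume "\<not> n < m"
    then obtain r where "alt j i n = alt j i m @ r"
      using alt_le_append[of m n j i] by auto
    then have "t @ [i] = rev r @ rev (alt i j (Suc m)) @ []"
      using t by (metis append_Nil2 alt.simps(2) rev_append rev_rev_ident rev.simps(2)
          append_assoc append_Cons)
    then show False using red that reduced_word_infix by metis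
  qed
  have "(A i j, A j i) \<in> {(0,0), (-1,-1), (-1,-2), (-2,-1), (-1,-3), (-3,-1)}"
    by (rule rank2_cases) (use gc ij lt in \<open>auto simp: gen_cartan_def\<close>)
  then consider "A i j = 0" "A j i = 0" | "A i j = -1" "A j i = -1"
    | "A i j = -1" "A j i = -2" | "A i j = -2" "A j i = -1"
    | "A i j = -1" "A j i = -3" | "A i j = -3" "A j i = -1"
    by auto
  then show ?thesis
  proof cases
    case 1
    have "\<not> reduced_word A ([i, j] @ [i])"
      by (rule not_reduced_word_snoc[where s' = "[j]"])
        (use d ij 1 in \<open>auto simp: fun_eq_iff refl_apply pairing_refl\<close>)
    then have "n < 2" using bound[of 2] by (simp add: eval_nat_numeral)
    then have "n \<in> {0, 1}" by auto
    then show ?thesis using pos d 1 by (auto simp: t pairing_refl)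
  next
    case 2
    have "\<not> reduced_word A ([j, i, j] @ [i])"
      by (rule not_reduced_word_snoc[where s' = "[i, j]"])
        (use d ij 2 in \<open>auto simp: fun_eq_iff refl_apply pairing_refl\<close>)
    then have "n < 3" using bound[of 3] by (simp add: eval_nat_numeral)
    then have "n \<in> {0, 1, 2}" by auto
    then show ?thesis using pos d 2 by (auto simp: t pairing_refl eval_nat_numeral)
  next
    case 3
    have "\<not> reduced_word A ([i, j, i, j] @ [i])"
      by (rule not_reduced_word_snoc[where s' = "[j, i, j]"])
        (use d ij 3 in \<open>auto simp: fun_eq_iff refl_apply pairing_refl\<close>)
    then have "n < 4" using bound[of 4] by (simp add: eval_nat_numeral)
    then have "n \<in> {0, 1, 2, 3}" by auto
    then show ?thesis using pos d 3 by (auto simp: t pairing_refl eval_nat_numeral)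
  next
    case 4
    have "\<not> reduced_word A ([i, j, i, j] @ [i])"
      by (rule not_reduced_word_snoc[where s' = "[j, i, j]"])
        (use d ij 4 in \<open>auto simp: fun_eq_iff refl_apply pairing_refl\<close>)
    then have "n < 4" using bound[of 4] by (simp add: eval_nat_numeral)
    then have "n \<in> {0, 1, 2, 3}" by auto
    then show ?thesis using pos d 4 by (auto simp: t pairing_refl eval_nat_numeral)
  next
    case 5
    have "\<not> reduced_word A ([i, j, i, j, i, j] @ [i])"
      by (rule not_reduced_word_snoc[where s' = "[j, i, j, i, j]"])
        (use d ij 5 in \<open>auto simp: fun_eq_iff refl_apply pairing_refl\<close>)
    then have "n < 6" using bound[of 6] by (simp add: eval_nat_numeral)
    then have "n \<in> {0, 1, 2, 3, 4, 5}" by auto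
    then show ?thesis using pos d 5 by (auto simp: t pairing_refl eval_nat_numeral)
  next
    case 6
    have "\<not> reduced_word A ([i, j, i, j, i, j] @ [i])"
      by (rule not_reduced_word_snoc[where s' = "[j, i, j, i, j]"])
        (use d ij 6 in \<open>auto simp: fun_eq_iff refl_apply pairing_refl\<close>)
    then have "n < 6" using bound[of 6] by (simp add: eval_nat_numeral)
    then have "n \<in> {0, 1, 2, 3, 4, 5}" by auto
    then show ?thesis using pos d 6 by (auto simp: t pairing_refl eval_nat_numeral)
  qed
qed

text \<open>The dihedral argument for Coxeter groups, phrased with strictly dominant weights instead of
  positive coroots so that the Weyl group only ever acts on the root lattice.\<close>
lemma reduced_word_pos:
  fixes A :: "'i::finite \<Rightarrow> 'i \<Rightarrow> int"
  assumes gc: "gen_cartan A" and lt: "\<And>i j. i \<noteq> j \<Longrightarrow> A i j * A j i < 4"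
    and pos: "\<And>j. pairing A j \<nu> > 0"
    and red: "reduced_word A (u @ [i])"
  shows "pairing A i (weyl_word A (rev u) \<nu>) > 0"
  using red
proof (induction "length u" arbitrary: u i rule: less_induct)
  case less
  have d: "\<forall>i. A i i = 2" using gc by (simp add: gen_cartan_def)
  show ?case
  proof (cases u rule: rev_cases)
    case Nil
    then show ?thesis using pos by simp
  next
    case (snoc u0 j)
    have ij: "i \<noteq> j"
      using less.prems reduced_word_infix[of A u0 "[j, j]" "[]"] not_reduced_word_square[of A j] d
      by (auto simp: snoc)
    \<comment> \<open>Factors the element of \<open>u\<close>, with lengths adding, so that the
      second factor lies in the dihedral subgroup of \<open>i\<close> and \<open>j\<close>. The
      shortest \<open>v\<close> is a minimal coset representative.\<close>
    define P where "P v t \<longleftrightarrow> weyl_word A (v @ t) = weyl_word A u \<and>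
      length (v @ t) = length u \<and> set t \<subseteq> {i, j}" for v t
    have "P u0 [j]" by (simp add: P_def snoc)
    then obtain v where v: "\<exists>t. P v t" and vmin: "\<And>v' t'. P v' t' \<Longrightarrow> length v \<le> length v'"
      using ex_has_least_nat[of "\<lambda>v. \<exists>t. P v t" u0 length] by blast
    then obtain t where t: "P v t" by blast
    have redu: "reduced_word A u"
      using less.prems reduced_word_infix[of A "[]" u "[i]"] by simp
    have vt: "weyl_word A (v @ t) = weyl_word A u" "length (v @ t) = length u" "set t \<subseteq> {i, j}"
      using t by (auto simp: P_def)
    have "reduced_word A (v @ t)"
      using reduced_word_cong[OF redu] vt by simp
    then have redv: "reduced_word A v"
      using reduced_word_infix[of A "[]" v t] by simp
    \<comment> \<open>If \<open>v @ [x]\<close> were not reduced, parity would give an equivalent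
      \<open>v'\<close> shorter than \<open>v\<close> itself; moving \<open>x\<close> into the
      second factor yields the pair \<open>v'\<close>, \<open>x # t\<close>, against
      minimality.\<close>
    have vx: "reduced_word A (v @ [x])" if x: "x \<in> {i, j}" for x
    proof (rule ccontr)
      assume "\<not> reduced_word A (v @ [x])"
      then obtain v' where v': "weyl_word A v' = weyl_word A (v @ [x])"
          "length v' < length (v @ [x])"
        unfolding reduced_word_def by (meson not_le)
      have "even (length v') \<longleftrightarrow> even (length (v @ [x]))"
        using weyl_word_parity[OF gc v'(1)] .
      with v'(2) have len: "length v' < length v"
        by (metis even_Suc length_append_singleton less_antisym)
      have "weyl_word A (v' @ x # t) = weyl_word A (v @ t)"
        using v'(1) d by (simp add: fun_eq_iff refl_refl)
      then have eq: "weyl_word A (v' @ x # t) = weyl_word A u" using vt by simp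
      then have "length u \<le> length (v' @ x # t)"
        using redu unfolding reduced_word_def by blast
      then have "P v' (x # t)"
        using eq vt len x by (auto simp: P_def)
      then show False using vmin len by (metis not_le)
    qed
    \<comment> \<open>The factorization \<open>u0\<close>, \<open>[j]\<close> bounds the minimum, so
      the induction hypothesis applies to \<open>v\<close> with either letter and supplies the two
      positive pairings for \<open>rank2_pos\<close>.\<close>
    have "length v < length u"
      using vmin[OF \<open>P u0 [j]\<close>] by (simp add: snoc)
    then have mu: "pairing A x (weyl_word A (rev v) \<nu>) > 0" if "x \<in> {i, j}" for x
      using less.hyps vx that by blast
    have "reduced_word A ((v @ t) @ [i])"
      by (rule reduced_word_cong[OF less.prems]) (use vt in \<open>auto simp flip: comp_assoc\<close>)
    then have "reduced_word A (t @ [i])"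
      using reduced_word_infix[of A v "t @ [i]" "[]"] by simp
    then have "pairing A i (weyl_word A (rev t) (weyl_word A (rev v) \<nu>)) > 0"
      using rank2_pos[OF gc ij lt[OF ij]] vt(3) mu by blast
    moreover have "weyl_word A (rev u) = weyl_word A (rev t) \<circ> weyl_word A (rev v)"
      using weyl_word_rev_cong[OF gc vt(1)] by simp
    ultimately show ?thesis by simp
  qed
qed

section \<open>Consequences of finite type\<close>

lemma finite_type_mult_less:
  fixes A :: "'i::finite \<Rightarrow> 'i \<Rightarrow> int"
  assumes "finite_type A" "i \<noteq> j"
  shows "A i j * A j i < 4"
proof -
  have d: "A i i = 2" "A j j = 2"
    using assms by (auto simp: finite_type_def gen_cartan_def)
  have "{p. p permutes {i, j}} = {id, Transposition.transpose i j}"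
    using permutes_doubleton_iff[of _ i j] by auto
  moreover have "id \<noteq> Transposition.transpose i j"
    using assms(2) by (metis id_apply transpose_apply_first)
  ultimately have "principal_minor A {i, j} = 4 - A i j * A j i"
    using assms(2) d by (simp add: principal_minor_def sign_swap_id)
  moreover have "principal_minor A {i, j} > 0"
    using assms(1) by (simp add: finite_type_def)
  ultimately show ?thesis by simp
qed

text \<open>The weight has to lie in the root lattice. The real solution with all pairings 1 exists
  because the determinant is nonzero; it is scaled by \<open>N\<close> and rounded down, where
  \<open>N\<close> exceeds the total rounding error of any row.\<close>

lemma finite_type_regular_dominant:
  fixes A :: "'i::finite \<Rightarrow> 'i \<Rightarrow> int"
  assumes "finite_type A"
  shows "\<exists>\<nu>. \<forall>i. pairing A i \<nu> > 0"
proof -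
  define M :: "real ^ 'i ^ 'i" where "M = (\<chi> i j. of_int (A i j))"
  have "det M = of_int (principal_minor A UNIV)"
    by (simp add: det_def principal_minor_def M_def)
  moreover have "principal_minor A UNIV > 0"
    using assms by (simp add: finite_type_def)
  ultimately have "invertible M"
    by (simp add: invertible_det_nz)
  then obtain M' where "M ** M' = mat 1"
    by (auto simp: invertible_def)
  then obtain x where x: "M *v x = (\<chi> i. 1)"
    by (metis matrix_vector_mul_assoc matrix_vector_mul_lid)
  define N where "N = 1 + (\<Sum>i\<in>UNIV. \<Sum>j\<in>UNIV. \<bar>A i j\<bar>)"
  define \<nu> where "\<nu> j = \<lfloor>of_int N * x $ j\<rfloor>" for j
  have "pairing A i \<nu> > 0" for i
  proof -
    have "(\<Sum>j\<in>UNIV. of_int (A i j) * x $ j) = 1"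
      using x by (simp add: M_def matrix_vector_mult_def vec_eq_iff)
    then have "of_int N = (\<Sum>j\<in>UNIV. of_int (A i j) * (of_int N * x $ j))"
      by (simp add: mult.left_commute flip: sum_distrib_left)
    also have "\<dots> \<le> (\<Sum>j\<in>UNIV. of_int (A i j * \<nu> j) + of_int \<bar>A i j\<bar>)"
    proof (rule sum_mono)
      fix j
      define r where "r = of_int N * x $ j - of_int (\<nu> j)"
      have "0 \<le> r" "r \<le> 1" unfolding r_def \<nu>_def by linarith+
      then have "\<bar>of_int (A i j) * r\<bar> \<le> of_int \<bar>A i j\<bar>"
        by (simp add: abs_mult mult_left_le)
      then show "of_int (A i j) * (of_int N * x $ j) \<le> of_int (A i j * \<nu> j) + of_int \<bar>A i j\<bar>"
        by (simp add: r_def algebra_simps)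
    qed
    also have "\<dots> = of_int (pairing A i \<nu> + (\<Sum>j\<in>UNIV. \<bar>A i j\<bar>))"
      by (simp add: pairing_def sum.distrib)
    finally have "N \<le> pairing A i \<nu> + (\<Sum>j\<in>UNIV. \<bar>A i j\<bar>)"
      by linarith
    moreover have "(\<Sum>j\<in>UNIV. \<bar>A i j\<bar>) \<le> (\<Sum>i\<in>UNIV. \<Sum>j\<in>UNIV. \<bar>A i j\<bar>)"
      by (rule member_le_sum) (auto intro: sum_nonneg)
    ultimately show ?thesis by (simp add: N_def)
  qed
  then show ?thesis by blast
qed

section \<open>Crystal operators as moves of integer vectors\<close>

text \<open>The signature of position m: f_i acts at the last, and e_i at the first, position carrying
  the letter i at which it is maximal.\<close>
definition sig :: "('i \<Rightarrow> 'i \<Rightarrow> int) \<Rightarrow> 'i \<Rightarrow> 'i list \<Rightarrow> (nat \<Rightarrow> int) \<Rightarrow> nat \<Rightarrow> int" where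
  "sig A i w f m = - f m - (\<Sum>j<m. A i (w ! j) * f j)"

text \<open>Functions on positions stand for crystal elements, so that updates and sums are
  pointwise; values from \<open>length w\<close> on are ignored.\<close>

definition vec_list :: "'i list \<Rightarrow> (nat \<Rightarrow> int) \<Rightarrow> int list" where
  "vec_list w f = map f [0..<length w]"

lemma vec_list_Nil [simp]: "vec_list [] f = []"
  by (simp add: vec_list_def)

lemma vec_list_Cons [simp]: "vec_list (k # w) f = f 0 # vec_list w (\<lambda>m. f (Suc m))"
  by (simp add: vec_list_def map_upt_Suc del: upt_Suc)

lemma sig_Cons_0 [simp]: "sig A i (k # w) f 0 = - f 0"
  by (simp add: sig_def)

lemma sig_Cons_Suc [simp]:
  "sig A i (k # w) f (Suc m) = sig A i w (\<lambda>m. f (Suc m)) m - f 0 * A i k"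
  by (simp add: sig_def sum.lessThan_Suc_shift del: sum.lessThan_Suc)

lemma sig_add: "sig A i w (\<lambda>m. f m + g m) l = sig A i w f l + sig A i w g l"
  by (simp add: sig_def algebra_simps sum.distrib)

lemma sig_cmult: "sig A i w (\<lambda>m. c * f m) l = c * sig A i w f l"
  by (simp add: sig_def right_diff_distrib sum_distrib_left mult.left_commute)

lemma sig_upd:
  assumes "w ! p = i" "A i i = 2"
  shows "sig A i w (f(p := f p + c)) l =
    sig A i w f l - (if l = p then c else if p < l then 2 * c else 0)"
proof -
  have "f(p := f p + c) = (\<lambda>m. f m + c * (if m = p then 1 else 0))" by auto
  moreover have "(\<Sum>j<l. A i (w ! j) * (if j = p then 1 else 0)) = (if p < l then 2 else 0)"
    using assms by (simp add: if_distrib cong: if_cong)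
  ultimately show ?thesis
    by (simp add: sig_add sig_cmult) (simp add: sig_def)
qed

section \<open>The tensor product rule in terms of signatures\<close>

lemma ceps_Cons:
  assumes "length w = length b"
  shows "ceps A i (k # w) (x # b) =
    max (eps1 i k x) (ceps A i w b - ereal (real_of_int (x * A i k)))"
  using assms by (cases w; cases b) (simp_all add: max_def)

lemma cf_Cons:
  assumes "length w = length b"
  shows "cf A i (k # w) (x # b) =
    (if phi1 i k x > ceps A i w b then (if i = k then Some ((x - 1) # b) else None)
     else map_option (Cons x) (cf A i w b))"
  using assms by (cases w; cases b) (simp_all add: phi1_def)

lemma length_vec_list [simp]: "length (vec_list w f) = length w"
  by (simp add: vec_list_def)

lemma ereal_diff_less: "(a :: ereal) - ereal x < ereal y \<longleftrightarrow> a < ereal (y + x)"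
  by (cases a) auto

text \<open>Unfolding the tensor rule shows \<open>ceps\<close> to be the maximal signature among
  positions with letter \<open>i\<close>. Stating it through strict upper bounds also covers words
  without \<open>i\<close>, where the value is -\<infinity>.\<close>

lemma ceps_less_iff:
  "ceps A i w (vec_list w f) < ereal (of_int c) \<longleftrightarrow>
    (\<forall>m<length w. w ! m = i \<longrightarrow> sig A i w f m < c)"
proof (induction w arbitrary: f c)
  case (Cons k w)
  have "ceps A i (k # w) (vec_list (k # w) f) < ereal (of_int c) \<longleftrightarrow>
     (i = k \<longrightarrow> - f 0 < c) \<and> ceps A i w (vec_list w (\<lambda>m. f (Suc m))) < ereal (of_int (c + f 0 * A i k))"
    by (auto simp: ceps_Cons eps1_def ereal_diff_less simp del: of_int_mult)
  also have "\<dots> \<longleftrightarrow> (\<forall>m<length (k # w). (k # w) ! m = i \<longrightarrow> sig A i (k # w) f m < c)"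
    unfolding Cons.IH by (auto simp: All_less_Suc2 algebra_simps)
  finally show ?case .
qed simp


text \<open>If the head has letter \<open>i\<close>, subtracting \<open>2 * f 0\<close> turns the
  comparison of \<open>phi1\<close> with \<open>ceps\<close> of the tail into one of signatures: the
  head is chosen only if it strictly beats the tail. Ties go right, hence the last maximum.\<close>

lemma cf_vec_list:
  assumes "A i i = 2" "m < length w" "w ! m = i"
    and "\<And>j. j < m \<Longrightarrow> w ! j = i \<Longrightarrow> sig A i w f j \<le> sig A i w f m"
    and "\<And>j. m < j \<Longrightarrow> j < length w \<Longrightarrow> w ! j = i \<Longrightarrow> sig A i w f j < sig A i w f m"
  shows "cf A i w (vec_list w f) = Some (vec_list w (f(m := f m - 1)))"
  using assms(2-)
proof (induction w arbitrary: f m)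
  case (Cons k w)
  define f' where "f' = (\<lambda>m. f (Suc m))"
  show ?case
  proof (cases m)
    case 0
    then have k: "k = i" using Cons.prems(2) by simp
    have "sig A i w f' j < f 0" if "j < length w" "w ! j = i" for j
      using Cons.prems(4)[of "Suc j"] that assms(1) by (simp add: 0 k f'_def)
    then have "ceps A i w (vec_list w f') < ereal (of_int (f 0))"
      by (simp add: ceps_less_iff)
    then show ?thesis
      by (simp add: cf_Cons phi1_def k 0 f'_def)
  next
    case (Suc m')
    \<comment> \<open>The head loses: for \<open>k \<noteq> i\<close> its \<open>phi1\<close> is
      -\<infinity>, and for \<open>k = i\<close> its signature \<open>- f 0\<close> is at most the
      one at \<open>m\<close>, namely \<open>sig A i w f' m' - 2 * f 0\<close>.\<close>
    have "\<not> ceps A i w (vec_list w f') < phi1 i k (f 0)"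
    proof
      assume *: "ceps A i w (vec_list w f') < phi1 i k (f 0)"
      then have k: "k = i" by (auto simp: phi1_def split: if_splits)
      with * have "ceps A i w (vec_list w f') < ereal (of_int (f 0))"
        by (simp add: phi1_def)
      then have "sig A i w f' m' < f 0"
        using Cons.prems by (auto simp: ceps_less_iff Suc)
      moreover have "- f 0 \<le> sig A i w f' m' - 2 * f 0"
        using Cons.prems(3)[of 0] assms(1) k by (simp add: Suc f'_def)
      ultimately show False by simp
    qed
    moreover have "cf A i w (vec_list w f') = Some (vec_list w (f'(m' := f' m' - 1)))"
    proof (rule Cons.IH)
      show "sig A i w f' j \<le> sig A i w f' m'" if "j < m'" "w ! j = i" for j
        using Cons.prems(3)[of "Suc j"] that by (simp add: Suc f'_def)
      show "sig A i w f' j < sig A i w f' m'" if "m' < j" "j < length w" "w ! j = i" for j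
        using Cons.prems(4)[of "Suc j"] that by (simp add: Suc f'_def)
    qed (use Cons.prems in \<open>simp_all add: Suc\<close>)
    moreover have "(\<lambda>n. (f(Suc m' := f (Suc m') - 1)) (Suc n)) = f'(m' := f' m' - 1)"
      by (auto simp: f'_def)
    ultimately show ?thesis
      by (simp add: cf_Cons Suc flip: f'_def)
  qed
qed simp

lemma cf_eq_None: "i \<notin> set w \<Longrightarrow> cf A i w b = None"
  by (induction A i w b rule: cf.induct) (auto simp: phi1_def)

lemma vec_list_cong: "(\<And>m. m < length w \<Longrightarrow> f m = g m) \<Longrightarrow> vec_list w f = vec_list w g"
  by (simp add: vec_list_def)

lemma vec_list_nth: "length b = length w \<Longrightarrow> vec_list w ((!) b) = b"
  by (metis vec_list_def map_nth)

lemma nth_vec_list [simp]: "m < length w \<Longrightarrow> vec_list w f ! m = f m"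
  by (simp add: vec_list_def)

lemma finite_first_max:
  fixes s :: "nat \<Rightarrow> int"
  assumes "finite S" "S \<noteq> {}"
  shows "\<exists>p\<in>S. (\<forall>j\<in>S. s j \<le> s p) \<and> (\<forall>j\<in>S. j < p \<longrightarrow> s j < s p)"
proof -
  define R where "R = {p \<in> S. s p = Max (s ` S)}"
  have "Max (s ` S) \<in> s ` S" using assms by simp
  then have "R \<noteq> {}" "finite R" using assms(1) by (auto simp: R_def)
  then have "Min R \<in> R" and "\<And>j. j \<in> R \<Longrightarrow> Min R \<le> j" by auto
  moreover have "s j \<le> Max (s ` S)" if "j \<in> S" for j using assms that by simp
  ultimately show ?thesis
    unfolding R_def by (intro bexI[of _ "Min R"]) (force simp: R_def order.strict_iff_order)+
qed

lemma finite_last_max: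
  fixes s :: "nat \<Rightarrow> int"
  assumes "finite S" "S \<noteq> {}"
  shows "\<exists>p\<in>S. (\<forall>j\<in>S. s j \<le> s p) \<and> (\<forall>j\<in>S. p < j \<longrightarrow> s j < s p)"
proof -
  define R where "R = {p \<in> S. s p = Max (s ` S)}"
  have "Max (s ` S) \<in> s ` S" using assms by simp
  then have "R \<noteq> {}" "finite R" using assms(1) by (auto simp: R_def)
  then have "Max R \<in> R" and "\<And>j. j \<in> R \<Longrightarrow> j \<le> Max R" by auto
  moreover have "s j \<le> Max (s ` S)" if "j \<in> S" for j using assms that by simp
  ultimately show ?thesis
    unfolding R_def by (intro bexI[of _ "Max R"]) (force simp: R_def order.strict_iff_order)+
qed

section \<open>Connectedness and translations\<close>

definition joined :: "('i::finite \<Rightarrow> 'i \<Rightarrow> int) \<Rightarrow> 'i list \<Rightarrow> (nat \<Rightarrow> int) \<Rightarrow> (nat \<Rightarrow> int) \<Rightarrow> bool" where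
  "joined A w f g \<longleftrightarrow>
    (vec_list w f, vec_list w g) \<in> (crystal_edges A w \<union> (crystal_edges A w)\<inverse>)\<^sup>*"

lemma joined_refl [simp]: "joined A w f f"
  by (simp add: joined_def)

lemma joined_trans: "joined A w f g \<Longrightarrow> joined A w g h \<Longrightarrow> joined A w f h"
  unfolding joined_def by (rule rtrancl_trans)

lemma joined_sym: "joined A w f g \<Longrightarrow> joined A w g f"
  unfolding joined_def
  by (metis converse_Un converse_converse rtrancl_converseI sup_commute)

text \<open>The hypotheses say that e_i acts on f at position p; the edge used is the one along f_i
  leading back.\<close>
lemma joined_step:
  assumes "A i i = 2" "p < length w" "w ! p = i"
    and "\<And>j. j < p \<Longrightarrow> w ! j = i \<Longrightarrow> sig A i w f j < sig A i w f p"
    and "\<And>j. p < j \<Longrightarrow> j < length w \<Longrightarrow> w ! j = i \<Longrightarrow> sig A i w f j \<le> sig A i w f p"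
  shows "joined A w f (f(p := f p + 1))"
proof -
  define g where "g = f(p := f p + 1)"
  have s: "sig A i w g l = sig A i w f l - (if l = p then 1 else if p < l then 2 else 0)" for l
    unfolding g_def using sig_upd[of w p i A f 1 l] assms by simp
  have "cf A i w (vec_list w g) = Some (vec_list w (g(p := g p - 1)))"
  proof (rule cf_vec_list)
    show "sig A i w g j \<le> sig A i w g p" if "j < p" "w ! j = i" for j
      using assms(4)[of j] that by (simp add: s)
    show "sig A i w g j < sig A i w g p" if "p < j" "j < length w" "w ! j = i" for j
      using assms(5)[of j] that by (simp add: s)
  qed (use assms in auto)
  moreover have "g(p := g p - 1) = f" by (simp add: g_def)
  ultimately have "(vec_list w g, vec_list w f) \<in> crystal_edges A w"
    by (auto simp: crystal_edges_def cellular_crystal_def)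
  then show ?thesis
    unfolding joined_def g_def by blast
qed

text \<open>Adding \<open>v\<close> shifts all signatures of one letter equally, so the last
  maximum, where f_i acts, stays at the same position.\<close>

lemma crystal_edge_translate:
  assumes diag: "\<And>i. A i i = 2"
    and v: "\<And>m. m < length w \<Longrightarrow> sig A (w ! m) w v m = c (w ! m)"
    and edge: "(b, b') \<in> crystal_edges A w"
  defines "T \<equiv> \<lambda>b. vec_list w (\<lambda>m. b ! m + v m)"
  shows "(T b, T b') \<in> crystal_edges A w"
proof -
  obtain i where b: "length b = length w" and i: "cf A i w b = Some b'"
    using edge by (auto simp: crystal_edges_def cellular_crystal_def)
  define f where "f = (!) b"
  define S where "S = {m. m < length w \<and> w ! m = i}"
  have "i \<in> set w" using i cf_eq_None by (metis option.distinct(1))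
  then have "S \<noteq> {}" "finite S" by (auto simp: S_def in_set_conv_nth)
  then obtain p where p: "p \<in> S" "\<And>j. j \<in> S \<Longrightarrow> sig A i w f j \<le> sig A i w f p"
      "\<And>j. j \<in> S \<Longrightarrow> p < j \<Longrightarrow> sig A i w f j < sig A i w f p"
    using finite_last_max[of S "sig A i w f"] by blast
  have pw: "p < length w" "w ! p = i" using p(1) by (auto simp: S_def)
  have "cf A i w (vec_list w f) = Some (vec_list w (f(p := f p - 1)))"
    by (rule cf_vec_list) (use diag p in \<open>auto simp: S_def\<close>)
  then have b': "b' = vec_list w (f(p := f p - 1))"
    using i b by (simp add: f_def vec_list_nth)
  define g where "g = (\<lambda>m. f m + v m)"
  have s: "sig A i w g m = sig A i w f m + c i" if "m \<in> S" for m
    using that v[of m] by (auto simp: S_def g_def sig_add)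
  have "cf A i w (vec_list w g) = Some (vec_list w (g(p := g p - 1)))"
  proof (rule cf_vec_list)
    show "sig A i w g j \<le> sig A i w g p" if "j < p" "w ! j = i" for j
    proof -
      have "j \<in> S" using that pw by (simp add: S_def)
      then show ?thesis using p by (simp add: s)
    qed
    show "sig A i w g j < sig A i w g p" if "p < j" "j < length w" "w ! j = i" for j
    proof -
      have "j \<in> S" using that by (simp add: S_def)
      then show ?thesis using p that by (simp add: s)
    qed
  qed (use diag pw in auto)
  moreover have "T b = vec_list w g"
    by (simp add: T_def g_def f_def)
  moreover have "T b' = vec_list w (g(p := g p - 1))"
    unfolding T_def by (rule vec_list_cong) (simp add: b' g_def)
  ultimately show ?thesis
    by (auto simp: crystal_edges_def cellular_crystal_def)
qed

lemma joined_translate: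
  assumes "\<And>i. A i i = 2"
    and "\<And>m. m < length w \<Longrightarrow> sig A (w ! m) w v m = c (w ! m)"
    and "joined A w f g"
  shows "joined A w (\<lambda>m. f m + v m) (\<lambda>m. g m + v m)"
proof -
  define T where "T = (\<lambda>b. vec_list w (\<lambda>m. b ! m + v m))"
  define R where "R = crystal_edges A w \<union> (crystal_edges A w)\<inverse>"
  have step: "(T b, T b') \<in> R" if "(b, b') \<in> R" for b b'
    using that crystal_edge_translate[of A w v c, OF assms(1,2)] by (auto simp: R_def T_def)
  have "(vec_list w f, vec_list w g) \<in> R\<^sup>*"
    using assms(3) by (simp add: joined_def R_def)
  then have "(T (vec_list w f), T (vec_list w g)) \<in> R\<^sup>*"
    by (induction rule: rtrancl_induct) (auto intro: step rtrancl_into_rtrancl)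
  moreover have "T (vec_list w h) = vec_list w (\<lambda>m. h m + v m)" for h
    unfolding T_def by (rule vec_list_cong) simp
  ultimately show ?thesis
    by (simp add: joined_def R_def)
qed

section \<open>Connecting deep translates to the origin\<close>

text \<open>While the entry at \<open>m\<close> is negative, its signature is positive and the
  earlier ones vanish, so e_i acts at \<open>m\<close>. A step lowers the signature at
  \<open>m\<close> by 1 and the later ones by 2, which preserves the hypothesis.\<close>

lemma joined_clear_position:
  assumes diag: "A i i = 2" and m: "m < length w" "w ! m = i"
    and "\<And>l. l < m \<Longrightarrow> f l = 0" "f m \<le> 0"
    and "\<And>l. m < l \<Longrightarrow> l < length w \<Longrightarrow> w ! l = i \<Longrightarrow> sig A i w f l \<le> sig A i w f m"
  shows "joined A w f (f(m := 0))"
  using assms(4-)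
proof (induction "nat (- f m)" arbitrary: f)
  case 0
  then have "f(m := 0) = f" by (auto simp: fun_eq_iff)
  then show ?case by simp
next
  case (Suc n)
  define g where "g = f(m := f m + 1)"
  have s: "sig A i w g l = sig A i w f l - (if l = m then 1 else if m < l then 2 else 0)" for l
    unfolding g_def using sig_upd[of w m i A f 1 l] assms by simp
  have "joined A w f g"
    unfolding g_def
  proof (rule joined_step[where i = i])
    show "sig A i w f j < sig A i w f m" if "j < m" for j
      using that Suc by (simp add: sig_def)
  qed (use Suc.prems diag m in auto)
  moreover have "joined A w g (g(m := 0))"
  proof (rule Suc.hyps(1))
    show "n = nat (- g m)" "g m \<le> 0" using Suc.hyps(2) by (auto simp: g_def)
    show "g l = 0" if "l < m" for l using that Suc.prems(1) by (simp add: g_def)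
    show "sig A i w g l \<le> sig A i w g m" if "m < l" "l < length w" "w ! l = i" for l
      using Suc.prems(3)[OF that] that by (simp add: s)
  qed
  moreover have "g(m := 0) = f(m := 0)" by (simp add: g_def)
  ultimately show ?case using joined_trans by metis
qed

text \<open>Each application of e_i at a position after m lowers the excess of the signatures over that
  at m, so after finitely many steps, independent of the translation, e_i acts at m.\<close>
lemma joined_lower_tail:
  fixes z v :: "nat \<Rightarrow> int"
  assumes diag: "A i i = 2" and m: "m < length w" "w ! m = i" and c: "c > 0"
    and v: "\<And>l. m \<le> l \<Longrightarrow> l < length w \<Longrightarrow> w ! l = i \<Longrightarrow>
      sig A i w (\<lambda>l. if l < m then 0 else v l) l = c"
  defines "s \<equiv> \<lambda>z. sig A i w (\<lambda>l. if l < m then 0 else z l)"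
    and "V \<equiv> \<lambda>N z l. if l < m then 0 else z l + N * v l"
  shows "\<exists>z' N0. (\<forall>l. m < l \<longrightarrow> l < length w \<longrightarrow> w ! l = i \<longrightarrow> s z' l \<le> s z' m) \<and>
    (\<forall>N\<ge>N0. joined A w (V N z) (V N z'))"
proof -
  define S where "S = {l. m \<le> l \<and> l < length w \<and> w ! l = i}"
  have fin: "finite S" by (simp add: S_def)
  have mS: "m \<in> S" using m by (simp add: S_def)
  show ?thesis
  proof (induction "\<Sum>l\<in>S. nat (s z l - s z m)" arbitrary: z rule: less_induct)
    case less
    show ?case
    proof (cases "\<forall>l\<in>S. s z l \<le> s z m")
      case True
      then show ?thesis by (intro exI[of _ z]) (auto simp: S_def)
    next
      case False
      \<comment> \<open>Here e_i acts once the zero signatures before \<open>m\<close> are exceeded.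
        Since \<open>m\<close> is not maximal, \<open>p\<close> comes after it and
        \<open>s z m\<close> is unchanged by the step.\<close>
      obtain p where p: "p \<in> S" "\<And>j. j \<in> S \<Longrightarrow> s z j \<le> s z p"
          "\<And>j. j \<in> S \<Longrightarrow> j < p \<Longrightarrow> s z j < s z p"
        using finite_first_max[of S "s z"] fin mS by blast
      have less_p: "s z m < s z p" using False p(2) by force
      then have "p \<noteq> m" by auto
      then have pw: "m < p" "p < length w" "w ! p = i" using p(1) by (auto simp: S_def)
      define z1 where "z1 = z(p := z p + 1)"
      have s1: "s z1 l = s z l - (if l = p then 1 else if p < l then 2 else 0)" for l
      proof -
        have "(\<lambda>l. if l < m then 0 else z1 l) =
            (\<lambda>l. if l < m then 0 else z l)(p := (if p < m then 0 else z p) + 1)"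
          using pw by (auto simp: z1_def)
        then show ?thesis
          unfolding s_def using sig_upd[of w p i A "\<lambda>l. if l < m then 0 else z l" 1 l] pw diag
          by simp
      qed
      \<comment> \<open>Termination measure: the positive excess at \<open>p\<close> drops by one
        and no other excess grows.\<close>
      have "(\<Sum>l\<in>S. nat (s z1 l - s z1 m)) < (\<Sum>l\<in>S. nat (s z l - s z m))"
        by (rule sum_strict_mono_ex1[OF fin]) (use pw p(1) less_p in \<open>auto simp: s1 intro!: bexI[of _ p]\<close>)
      from less[OF this] obtain z' N1 where
          z': "\<forall>l. m < l \<longrightarrow> l < length w \<longrightarrow> w ! l = i \<longrightarrow> s z' l \<le> s z' m"
          "\<forall>N\<ge>N1. joined A w (V N z1) (V N z')" by blast
      \<comment> \<open>On \<open>S\<close> the signatures of \<open>V N z\<close> are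
        \<open>s z l + N * c\<close> with \<open>c \<ge> 1\<close>. The common shift leaves
        \<open>p\<close> independent of \<open>N\<close>, and the bound on \<open>N\<close> makes
        the maximum positive.\<close>
      have step: "joined A w (V N z) (V N z1)" if N: "N \<ge> \<bar>s z p\<bar> + 1" for N
      proof -
        have sV: "sig A i w (V N z) l = s z l + N * c" if "l \<in> S" for l
        proof -
          have "V N z = (\<lambda>l. (if l < m then 0 else z l) + N * (if l < m then 0 else v l))"
            by (auto simp: V_def)
          then show ?thesis
            using v[of l] that by (simp add: sig_add sig_cmult s_def S_def)
        qed
        have "N * 1 \<le> N * c" using c N by (intro mult_left_mono) auto
        then have pos: "sig A i w (V N z) p > 0" using N by (simp add: sV[OF p(1)])
        have "joined A w (V N z) ((V N z)(p := V N z p + 1))"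
        proof (rule joined_step[where i = i and p = p])
          show "sig A i w (V N z) j < sig A i w (V N z) p" if "j < p" "w ! j = i" for j
          proof (cases "j < m")
            case True
            then have "sig A i w (V N z) j = 0" by (simp add: sig_def V_def)
            then show ?thesis using pos by simp
          next
            case False
            then have "j \<in> S" using that pw by (simp add: S_def)
            then show ?thesis using p that by (simp add: sV)
          qed
          show "sig A i w (V N z) j \<le> sig A i w (V N z) p"
            if "p < j" "j < length w" "w ! j = i" for j
          proof -
            have "j \<in> S" using that pw by (simp add: S_def)
            then show ?thesis using p that by (simp add: sV)
          qed
        qed (use diag pw in auto)
        moreover have "(V N z)(p := V N z p + 1) = V N z1"
          using pw by (auto simp: V_def z1_def)
        ultimately show ?thesis by simp
      qed
      have "\<forall>N\<ge>max N1 (\<bar>s z p\<bar> + 1). joined A w (V N z) (V N z')"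
        using step z'(2) joined_trans by (metis max.bounded_iff)
      then show ?thesis using z'(1) by blast
    qed
  qed
qed

text \<open>Along this vector the signature at m equals the pairing of the m-th simple coroot of the word
  with the weight, hence depends only on the letter at m: adding it commutes with the crystal
  operators.\<close>
definition trans_vec :: "('i::finite \<Rightarrow> 'i \<Rightarrow> int) \<Rightarrow> 'i list \<Rightarrow> ('i \<Rightarrow> int) \<Rightarrow> nat \<Rightarrow> int" where
  "trans_vec A w \<nu> m = - pairing A (w ! m) (weyl_word A (rev (take m w)) \<nu>)"

text \<open>Telescoping: the reflection at position j changes the pairing by
  \<open>A i (w ! j) * trans_vec A w \<nu> j\<close>. The case \<open>m = 0\<close> gives
  translation invariance; general \<open>m\<close> serves after the first \<open>m\<close>
  coordinates have been cleared.\<close>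

lemma sig_trans_vec_tail:
  assumes "m \<le> l" "l < length w" "w ! l = i"
  shows "sig A i w (\<lambda>l. if l < m then 0 else trans_vec A w \<nu> l) l =
    pairing A i (weyl_word A (rev (take m w)) \<nu>)"
proof -
  define L where "L n = weyl_word A (rev (take n w)) \<nu>" for n
  have "pairing A i (L n) = pairing A i (L m) + (\<Sum>j=m..<n. A i (w ! j) * trans_vec A w \<nu> j)"
    if "m \<le> n" "n \<le> length w" for n
    using that
  proof (induction n rule: dec_induct)
    case (step n)
    have "L (Suc n) = refl A (w ! n) (L n)"
      using step by (simp add: L_def take_Suc_conv_app_nth)
    then show ?case
      using step by (simp add: pairing_refl trans_vec_def L_def)
  qed simp
  from this[of l] have "pairing A i (L l) =
      pairing A i (L m) + (\<Sum>j=m..<l. A i (w ! j) * trans_vec A w \<nu> j)"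
    using assms by simp
  moreover have "(\<Sum>j<l. A i (w ! j) * (if j < m then 0 else trans_vec A w \<nu> j)) =
      (\<Sum>j=m..<l. A i (w ! j) * trans_vec A w \<nu> j)"
    by (rule sum.mono_neutral_cong_right) auto
  ultimately show ?thesis
    using assms by (simp add: sig_def L_def trans_vec_def)
qed

text \<open>Downward induction on the number \<open>m\<close> of cleared coordinates. The offset
  \<open>z\<close> is arbitrary because preparing position \<open>m\<close> alters it, by an amount
  independent of \<open>N\<close>.\<close>

lemma joined_translate_zero:
  fixes A :: "'i::finite \<Rightarrow> 'i \<Rightarrow> int"
  assumes diag: "\<And>i. A i i = 2"
    and neg: "\<And>m. m < length w \<Longrightarrow> trans_vec A w \<nu> m < 0"
    and "m \<le> length w"
  shows "\<exists>N0. \<forall>N\<ge>N0. joined A w (\<lambda>l. if l < m then 0 else z l + N * trans_vec A w \<nu> l) (\<lambda>_. 0)"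
  using assms(3)
proof (induction m arbitrary: z rule: inc_induct)
  case base
  have "vec_list w (\<lambda>l. if l < length w then 0 else z l + N * trans_vec A w \<nu> l) =
      vec_list w (\<lambda>_. 0)" for N
    by (rule vec_list_cong) simp
  then show ?case by (simp add: joined_def)
next
  case (step m)
  define i where "i = w ! m"
  define v where "v = trans_vec A w \<nu>"
  define V where "V m N z l = (if l < m then 0 else z l + N * v l)" for m l :: nat and N z
  define s where "s z = sig A i w (\<lambda>l. if l < m then 0 else z l)" for z
  define c where "c = pairing A i (weyl_word A (rev (take m w)) \<nu>)"
  have vm: "v m = - c" by (simp add: v_def trans_vec_def c_def i_def)
  have c: "c > 0" using neg[of m] step vm by (simp add: v_def)
  have vc: "sig A i w (\<lambda>l. if l < m then 0 else v l) l = c"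
    if "m \<le> l" "l < length w" "w ! l = i" for l
    unfolding v_def c_def using that by (rule sig_trans_vec_tail)
  obtain z' N1 where z': "\<And>l. m < l \<Longrightarrow> l < length w \<Longrightarrow> w ! l = i \<Longrightarrow> s z' l \<le> s z' m"
      and N1: "\<And>N. N \<ge> N1 \<Longrightarrow> joined A w (V m N z) (V m N z')"
    using joined_lower_tail[where A = A and i = i and m = m and w = w and c = c and v = v and z = z]
      diag step c vc unfolding V_def s_def i_def by blast
  obtain N2 where N2: "\<And>N. N \<ge> N2 \<Longrightarrow> joined A w (V (Suc m) N z') (\<lambda>_. 0)"
    using step.IH[of z'] unfolding V_def v_def by blast
  have "joined A w (V m N z) (\<lambda>_. 0)" if N: "N \<ge> max (max N1 N2) \<bar>z' m\<bar>" for N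
  proof -
    have "joined A w (V m N z') ((V m N z')(m := 0))"
    proof (rule joined_clear_position[where i = i])
      \<comment> \<open>As \<open>v m = - c\<close> with \<open>c \<ge> 1\<close>, any
        \<open>N\<close> from \<bar>z' m\<bar> on makes the entry at \<open>m\<close>
        nonpositive.\<close>
      have "N * 1 \<le> N * c" using c N by (intro mult_left_mono) auto
      moreover have "z' m \<le> N" using N by auto
      ultimately show "V m N z' m \<le> 0" by (simp add: V_def vm)
      have "V m N z' = (\<lambda>l. (if l < m then 0 else z' l) + N * (if l < m then 0 else v l))"
        by (auto simp: V_def)
      then have sV: "sig A i w (V m N z') l = s z' l + N * c"
        if "m \<le> l" "l < length w" "w ! l = i" for l
        using vc[OF that] by (simp add: sig_add sig_cmult s_def)
      show "sig A i w (V m N z') l \<le> sig A i w (V m N z') m"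
        if "m < l" "l < length w" "w ! l = i" for l
        using z'[OF that] sV[of l] sV[of m] that step.hyps by (simp flip: i_def)
    qed (use diag step in \<open>auto simp: V_def i_def\<close>)
    moreover have "(V m N z')(m := 0) = V (Suc m) N z'"
      by (auto simp: V_def less_Suc_eq)
    ultimately show ?thesis
      using N1[of N] N2[of N] N joined_trans by (metis max.bounded_iff)
  qed
  then show ?case unfolding V_def v_def by blast
qed

theorem theorem8p7:
  fixes A :: "'i::finite \<Rightarrow> 'i \<Rightarrow> int" and w :: "'i list"
  assumes "simple_cartan A"
    and "reduced_word A w"
  shows "crystal_connected A w"
  unfolding crystal_connected_def
proof (intro ballI)
  fix b b' assume b: "b \<in> cellular_crystal w" "b' \<in> cellular_crystal w"
  have ft: "finite_type A" using assms(1) by (simp add: simple_cartan_def)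
  then have gc: "gen_cartan A" by (simp add: finite_type_def)
  obtain \<nu> where \<nu>: "\<And>i. pairing A i \<nu> > 0"
    using finite_type_regular_dominant[OF ft] by blast
  define v where "v = trans_vec A w \<nu>"
  have neg: "v m < 0" if "m < length w" for m
  proof -
    have "reduced_word A (take m w @ [w ! m])"
      using reduced_word_infix[of A "[]" "take (Suc m) w" "drop (Suc m) w"] assms(2) that
      by (simp only: append_Nil append_take_drop_id flip: take_Suc_conv_app_nth)
    then show ?thesis
      using reduced_word_pos[OF gc finite_type_mult_less[OF ft] \<nu>] by (simp add: v_def trans_vec_def)
  qed
  have deep: "\<exists>N0. \<forall>N\<ge>N0. joined A w (\<lambda>l. z l + N * v l) (\<lambda>_. 0)" for z
    using joined_translate_zero[of A w \<nu> 0 z] gen_cartan_diag[OF gc] neg by (simp add: v_def)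
  \<comment> \<open>Both elements must be translated by the same multiple of \<open>v\<close>, so
    all large \<open>N\<close> are needed, not just one.\<close>
  obtain N1 N2 where "\<forall>N\<ge>N1. joined A w (\<lambda>l. b ! l + N * v l) (\<lambda>_. 0)"
      and "\<forall>N\<ge>N2. joined A w (\<lambda>l. b' ! l + N * v l) (\<lambda>_. 0)"
    using deep by meson
  then obtain N where "joined A w (\<lambda>l. b ! l + N * v l) (\<lambda>_. 0)"
      "joined A w (\<lambda>l. b' ! l + N * v l) (\<lambda>_. 0)"
    by (metis max.cobounded1 max.cobounded2)
  then have j: "joined A w (\<lambda>l. b ! l + N * v l) (\<lambda>l. b' ! l + N * v l)"
    using joined_sym joined_trans by metis
  \<comment> \<open>The path is carried back by \<open>- N * v\<close>, whose signature depends only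
    on the letter.\<close>
  have "sig A (w ! m) w (\<lambda>l. - N * v l) m = - N * pairing A (w ! m) \<nu>" if "m < length w" for m
    using sig_trans_vec_tail[of 0 m w "w ! m" A \<nu>] that by (simp only: sig_cmult) (simp add: v_def)
  from joined_translate[where c = "\<lambda>i. - N * pairing A i \<nu>", OF gen_cartan_diag[OF gc] this j]
  have "joined A w ((!) b) ((!) b')"
    by simp
  then show "(b, b') \<in> (crystal_edges A w \<union> (crystal_edges A w)\<inverse>)\<^sup>*"
    using b by (simp add: joined_def vec_list_nth cellular_crystal_def)
qed

end
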